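(* Let $A,B \subset \mathbb{R}$ be finite sets, let $G \subset A \times B$, and let $\lambda \in \mathbb{R} \setminus \{-1,0,1\}$. Then \[ \max \{|A+_G B|,\ |A+_G \lambda B|,\ |A \cdot_G B| \} \gg |G|^{6/11}, \] where the implied constant is absolute.
   Context: For finite $A,B\subset\mathbb{R}$ and $G\subset A\times B$: $A+_G B:=\{a+b : (a,b)\in G\}$, $A+_G \lambda B:=\{a+\lambda b : (a,b)\in G\}$, and $A\cdot_G B:=\{ab : (a,b)\in G\}$. The notation $X\gg Y$ means $X\ge cY$ for some absolute constant $c>0$. *)

theory Defs
  imports Complex_Main
begin

text \<open>
  Sums, dilated sums and products along a graph \<open>G \<subseteq> A \<times> B\<close>.  The ambient sets \<open>A\<close> and \<open>B\<close>
  are not arguments, since the resulting sets depend on \<open>G\<close> only.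
\<close>

definition sum_along :: "(real \<times> real) set \<Rightarrow> real set" where
  "sum_along G = {a + b | a b. (a, b) \<in> G}"

text \<open>
  In the set \<open>A +\<^sub>G \<lambda>B\<close> the graph still lives on \<open>A \<times> B\<close>, not on \<open>A \<times> \<lambda>B\<close>.
\<close>

definition dilated_sum_along :: "real \<Rightarrow> (real \<times> real) set \<Rightarrow> real set" where
  "dilated_sum_along l G = {a + l * b | a b. (a, b) \<in> G}"

definition prod_along :: "(real \<times> real) set \<Rightarrow> real set" where
  "prod_along G = {a * b | a b. (a, b) \<in> G}"

end

theory Submission
  imports Defs "HOL-Analysis.Convex" "HOL-Computational_Algebra.Polynomial"
begin

text \<open>
  With \<open>s = a + b\<close> and \<open>t = a + \<lambda>b\<close> the product \<open>ab\<close> is, up to a constant factor, the quadratic form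
  \<open>\<lambda>s\<^sup>2 - (\<lambda> + 1)ts + t\<^sup>2\<close>. Let \<open>N\<close> bound the three sets. By Cauchy-Schwarz over the values of the
  product, \<open>|G|\<^sup>2\<close> is at most \<open>N\<close> times the number of collisions of the form on the \<open>N \<times> N\<close> grid of
  pairs \<open>(s, t)\<close>. A collision of \<open>(x, t)\<close> with \<open>(y, t')\<close> is an incidence of the point \<open>(x, y)\<close> with a
  hyperbola determined by \<open>(t, t')\<close>. Cut the grid of points into blocks of side \<open>m\<close>: a hyperbola meets
  \<open>O(N/m)\<close> blocks, and two points off the diagonals \<open>x = \<plusminus>y\<close> lie on at most two common hyperbolas, so
  there are \<open>O(N\<^sup>3/m + N\<^sup>2m\<^sup>2)\<close> collisions. Choosing \<open>m\<close> of order \<open>N\<^bsup>1/3\<^esup>\<close> gives \<open>|G|\<^sup>2 = O(N\<^bsup>11/3\<^esup>)\<close>.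
\<close>

section \<open>Counting collisions of a map\<close>

text \<open>Fibre sizes sum to \<open>card A\<close>, and their squares sum to the number of
  collisions; Cauchy-Schwarz over the image compares the two.\<close>

lemma card_squared_le_card_image_times_collisions:
  assumes "finite A"
  shows "real (card A) ^ 2 \<le> real (card (f ` A)) * real (card {(x, y) \<in> A \<times> A. f x = f y})"
proof -
  let ?F = "\<lambda>z. {x \<in> A. f x = z}"
  have "real (card A) = (\<Sum>z\<in>f ` A. real (card (?F z)))"
    using sum.image_gen[OF assms, of "\<lambda>_. 1::real" f] by simp
  then have "real (card A) ^ 2 \<le> (\<Sum>z\<in>f ` A. real (card (?F z)) ^ 2) * real (card (f ` A))"
    using sum_squared_le_sum_of_squares[of "\<lambda>z. real (card (?F z))" "f ` A"] by simp
  moreover have "card {(x, y) \<in> A \<times> A. f x = f y} = (\<Sum>z\<in>f ` A. card (?F z) ^ 2)"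
  proof -
    have "{(x, y) \<in> A \<times> A. f x = f y} = (\<Union>z\<in>f ` A. ?F z \<times> ?F z)" by auto
    moreover have "card (\<Union>z\<in>f ` A. ?F z \<times> ?F z) = (\<Sum>z\<in>f ` A. card (?F z \<times> ?F z))"
      using assms by (intro card_UN_disjoint) auto
    ultimately show ?thesis by (simp add: card_cartesian_product power2_eq_square)
  qed
  ultimately show ?thesis by (simp add: mult.commute)
qed

text \<open>Fix one representative \<open>rep k\<close> in each fibre. Any other point collides with
  the representative of its own fibre, and distinct points give distinct pairs. Later
  \<open>E\<close> is the set of grid points on one hyperbola and \<open>h\<close> sends a point to
  its cell.\<close>

lemma card_le_card_image_plus_collisions:
  assumes "finite E"
  shows "card E \<le> card (h ` E) + card {(p, q) \<in> E \<times> E. p \<noteq> q \<and> h p = h q}"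
proof -
  define rep where "rep k = (SOME q. q \<in> E \<and> h q = k)" for k
  have rep: "rep (h p) \<in> E \<and> h (rep (h p)) = h p" if "p \<in> E" for p
    unfolding rep_def by (rule someI[of _ p]) (use that in auto)
  let ?D = "{p \<in> E. rep (h p) \<noteq> p}"
  have "E \<subseteq> rep ` h ` E \<union> ?D"
  proof
    fix p assume "p \<in> E"
    then show "p \<in> rep ` h ` E \<union> ?D"
      by (cases "rep (h p) = p") (simp_all, metis imageI)
  qed
  then have "card E \<le> card (rep ` h ` E \<union> ?D)" using assms by (intro card_mono) auto
  also have "\<dots> \<le> card (rep ` h ` E) + card ?D" by (rule card_Un_le)
  also have "card (rep ` h ` E) \<le> card (h ` E)" using assms by (intro card_image_le) auto
  also have "card ?D \<le> card {(p, q) \<in> E \<times> E. p \<noteq> q \<and> h p = h q}"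
  proof (rule card_inj_on_le[where f = "\<lambda>p. (p, rep (h p))"])
    show "inj_on (\<lambda>p. (p, rep (h p))) ?D" by (simp add: inj_on_def)
    show "(\<lambda>p. (p, rep (h p))) ` ?D \<subseteq> {(p, q) \<in> E \<times> E. p \<noteq> q \<and> h p = h q}"
      using rep by force
    show "finite {(p, q) \<in> E \<times> E. p \<noteq> q \<and> h p = h q}"
      by (rule finite_subset[of _ "E \<times> E"]) (use assms in auto)
  qed
  finally show ?thesis by simp
qed

section \<open>Grid cells met by a hyperbola\<close>

text \<open>Along a chain of cells the coordinate sum strictly increases, so it is injective there,
  and it stays below \<open>2 * R\<close>.\<close>

lemma card_chain_le:
  fixes u v :: "'a \<Rightarrow> nat"
  assumes chain: "\<And>p q. p \<in> E \<Longrightarrow> q \<in> E \<Longrightarrow> (u p \<le> u q \<and> v p \<le> v q) \<or> (u q \<le> u p \<and> v q \<le> v p)"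
    and R: "\<And>p. p \<in> E \<Longrightarrow> u p < R \<and> v p < R"
  shows "card ((\<lambda>p. (u p, v p)) ` E) \<le> 2 * R"
proof -
  have "card ((\<lambda>p. (u p, v p)) ` E) \<le> card {..<2 * R}"
  proof (rule card_inj_on_le[where f = "\<lambda>(i, j). i + j"])
    show "inj_on (\<lambda>(i, j). i + j) ((\<lambda>p. (u p, v p)) ` E)"
      using chain by (fastforce simp: inj_on_def)
    show "(\<lambda>(i, j). i + j) ` (\<lambda>p. (u p, v p)) ` E \<subseteq> {..<2 * R}"
      using R by fastforce
  qed simp
  then show ?thesis by simp
qed

text \<open>The reflection \<open>j \<mapsto> R - 1 - j\<close> of the second coordinate turns this
  into a chain; truncated subtraction loses nothing because \<open>v p < R\<close>.\<close>

lemma card_antichain_le: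
  fixes u v :: "'a \<Rightarrow> nat"
  assumes anti: "\<And>p q. p \<in> E \<Longrightarrow> q \<in> E \<Longrightarrow> (u p \<le> u q \<and> v q \<le> v p) \<or> (u q \<le> u p \<and> v p \<le> v q)"
    and R: "\<And>p. p \<in> E \<Longrightarrow> u p < R \<and> v p < R"
  shows "card ((\<lambda>p. (u p, v p)) ` E) \<le> 2 * R"
proof -
  have "card ((\<lambda>p. (u p, v p)) ` E) \<le> card ((\<lambda>p. (u p, R - 1 - v p)) ` E)"
  proof (rule surj_card_le[where f = "\<lambda>(i, j). (i, R - 1 - j)", rotated])
    show "(\<lambda>p. (u p, v p)) ` E \<subseteq> (\<lambda>(i, j). (i, R - 1 - j)) ` (\<lambda>p. (u p, R - 1 - v p)) ` E"
      using R by (force simp: image_iff)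
    have "(\<lambda>p. (u p, R - 1 - v p)) ` E \<subseteq> {..<R} \<times> {..R}" using R by auto
    then show "finite ((\<lambda>p. (u p, R - 1 - v p)) ` E)" by (rule finite_subset) simp
  qed
  also have "\<dots> \<le> 2 * R"
  proof (rule card_chain_le)
    fix p q assume "p \<in> E" "q \<in> E"
    then show "(u p \<le> u q \<and> R - 1 - v p \<le> R - 1 - v q) \<or> (u q \<le> u p \<and> R - 1 - v q \<le> R - 1 - v p)"
      using anti[of p q] by (auto intro: diff_le_mono2)
  next
    fix p assume "p \<in> E"
    then show "u p < R \<and> R - 1 - v p < R" using R[of p] by auto
  qed
  finally show ?thesis .
qed

text \<open>
  On each of the four quadrants around its centre the hyperbola is a monotone curve, so the cells
  that it meets there form a chain or an antichain.
\<close>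

lemma card_hyperbola_cells_le:
  fixes S :: "real set" and c :: "real \<Rightarrow> nat"
  assumes mono: "mono_on S c" and R: "\<And>x. x \<in> S \<Longrightarrow> c x < R"
    and E: "E \<subseteq> S \<times> S"
    and hyp: "\<And>x y. (x, y) \<in> E \<Longrightarrow> (x - a)\<^sup>2 - (y - b)\<^sup>2 = d"
  shows "card (map_prod c c ` E) \<le> 8 * R"
proof -
  \<comment> \<open>The four quadrants around the centre \<open>(a, b)\<close>; each contributes at
    most \<open>2 * R\<close> cells, whence the factor 8.\<close>
  define Q where "Q \<sigma> \<tau> = {(x, y) \<in> E. (a \<le> x) = \<sigma> \<and> (b \<le> y) = \<tau>}" for \<sigma> \<tau>
  have map_prod_eq: "map_prod c c = (\<lambda>p. (c (fst p), c (snd p)))" by auto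
  have QS: "fst p \<in> S \<and> snd p \<in> S" if "p \<in> Q \<sigma> \<tau>" for p \<sigma> \<tau>
    using that E by (auto simp: Q_def)
  have cm: "c x \<le> c y" if "x \<in> S" "y \<in> S" "x \<le> y" for x y
    using mono that by (auto simp: mono_on_def)
  \<comment> \<open>The two squares differ by the constant \<open>d\<close>, so the horizontal and
    vertical distances from the centre grow together. With equal signs
    \<open>\<sigma> = \<tau>\<close> the coordinates then move in the same direction, otherwise in
    opposite ones.\<close>
  have sq: "\<bar>fst p - a\<bar> \<le> \<bar>fst q - a\<bar> \<longleftrightarrow> \<bar>snd p - b\<bar> \<le> \<bar>snd q - b\<bar>"
    if "p \<in> Q \<sigma> \<tau>" "q \<in> Q \<sigma> \<tau>" for p q \<sigma> \<tau>
  proof -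
    have "(fst p - a)\<^sup>2 - (snd p - b)\<^sup>2 = (fst q - a)\<^sup>2 - (snd q - b)\<^sup>2"
      using that hyp by (auto simp: Q_def)
    then have "(fst p - a)\<^sup>2 \<le> (fst q - a)\<^sup>2 \<longleftrightarrow> (snd p - b)\<^sup>2 \<le> (snd q - b)\<^sup>2" by linarith
    then show ?thesis by (simp add: abs_le_square_iff)
  qed
  have le: "card (map_prod c c ` Q \<sigma> \<tau>) \<le> 2 * R" for \<sigma> \<tau>
  proof (cases "\<sigma> = \<tau>")
    case True
    show ?thesis unfolding map_prod_eq
    proof (rule card_chain_le)
      fix p q assume pq: "p \<in> Q \<sigma> \<tau>" "q \<in> Q \<sigma> \<tau>"
      then have "(fst p \<le> fst q \<and> snd p \<le> snd q) \<or> (fst q \<le> fst p \<and> snd q \<le> snd p)"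
        using True sq[OF pq] sq[OF pq(2,1)] by (cases \<sigma>) (auto simp: Q_def)
      then show "(c (fst p) \<le> c (fst q) \<and> c (snd p) \<le> c (snd q)) \<or>
          (c (fst q) \<le> c (fst p) \<and> c (snd q) \<le> c (snd p))"
        using cm QS pq by blast
    qed (use QS R in blast)
  next
    case False
    show ?thesis unfolding map_prod_eq
    proof (rule card_antichain_le)
      fix p q assume pq: "p \<in> Q \<sigma> \<tau>" "q \<in> Q \<sigma> \<tau>"
      then have "(fst p \<le> fst q \<and> snd q \<le> snd p) \<or> (fst q \<le> fst p \<and> snd p \<le> snd q)"
        using False sq[OF pq] sq[OF pq(2,1)] by (cases \<sigma>) (auto simp: Q_def)
      then show "(c (fst p) \<le> c (fst q) \<and> c (snd q) \<le> c (snd p)) \<or>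
          (c (fst q) \<le> c (fst p) \<and> c (snd p) \<le> c (snd q))"
        using cm QS pq by blast
    qed (use QS R in blast)
  qed
  have "E = Q True True \<union> Q True False \<union> Q False True \<union> Q False False"
    by (auto simp: Q_def)
  then have "map_prod c c ` E = map_prod c c ` Q True True \<union> map_prod c c ` Q True False
      \<union> map_prod c c ` Q False True \<union> map_prod c c ` Q False False"
    by (metis image_Un)
  then have "card (map_prod c c ` E) \<le> card (map_prod c c ` Q True True) + card (map_prod c c ` Q True False)
      + card (map_prod c c ` Q False True) + card (map_prod c c ` Q False False)"
    by (simp only:) (intro order_trans[OF card_Un_le] add_mono order_refl)
  then show ?thesis
    using le[of True True] le[of True False] le[of False True] le[of False False] by linarith
qed

section \<open>Cutting a finite set of reals into blocks\<close>

text \<open>Blocks are cut by rank in \<open>S\<close> rather than by value, so that their sizes are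
  controlled however unevenly \<open>S\<close> is spaced.\<close>

definition block :: "real set \<Rightarrow> nat \<Rightarrow> real \<Rightarrow> nat" where
  "block S m x = card {s \<in> S. s < x} div m"

lemma mono_on_block: "finite S \<Longrightarrow> mono_on S (block S m)"
  unfolding block_def by (intro mono_onI div_le_mono card_mono) auto

lemma block_less: "finite S \<Longrightarrow> block S m x < card S div m + 1"
  unfolding block_def by (simp add: less_Suc_eq_le div_le_mono card_mono)

text \<open>Rank is injective on \<open>S\<close>, and the ranks in block \<open>k\<close> lie in an
  interval of \<open>m\<close> integers.\<close>

lemma card_block_le:
  assumes "finite S" "m > 0"
  shows "card {y \<in> S. block S m y = k} \<le> m"
proof -
  let ?r = "\<lambda>x. card {s \<in> S. s < x}"
  have "card {y \<in> S. block S m y = k} \<le> card {k * m..<k * m + m}"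
  proof (rule card_inj_on_le[where f = ?r])
    have "?r x < ?r y" if "x \<in> S" "x < y" for x y
      using that assms by (intro psubset_card_mono) auto
    then show "inj_on ?r {y \<in> S. block S m y = k}"
      by (intro linorder_inj_onI) fastforce+
    show "?r ` {y \<in> S. block S m y = k} \<subseteq> {k * m..<k * m + m}"
      using assms(2) by (auto simp: block_def) (metis add.commute dividend_less_div_times)
  qed simp
  then show ?thesis by simp
qed

section \<open>The quadratic form and its collision curves\<close>

lemma card_quadratic_roots_le:
  fixes a b c :: real
  assumes "a \<noteq> 0 \<or> b \<noteq> 0 \<or> c \<noteq> 0"
  shows "finite {x. a * x\<^sup>2 + b * x + c = 0}" "card {x. a * x\<^sup>2 + b * x + c = 0} \<le> 2"
proof -
  have eq: "{x. a * x\<^sup>2 + b * x + c = 0} = {x. poly [:c, b, a:] x = 0}"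
    by (auto simp: power2_eq_square algebra_simps)
  have nz: "[:c, b, a:] \<noteq> 0" using assms by auto
  show "finite {x. a * x\<^sup>2 + b * x + c = 0}" unfolding eq by (rule poly_roots_finite[OF nz])
  have "degree [:c, b, a:] \<le> 2" by (auto simp: degree_pCons_eq_if)
  then show "card {x. a * x\<^sup>2 + b * x + c = 0} \<le> 2"
    unfolding eq using card_poly_roots_bound[OF nz] by linarith
qed

text \<open>This is \<open>(t - x) * (t - l * x)\<close>. At \<open>x = a + b\<close>,
  \<open>t = a + l * b\<close> the factors are \<open>(l - 1) * b\<close> and
  \<open>(1 - l) * a\<close>.\<close>

definition form :: "real \<Rightarrow> real \<Rightarrow> real \<Rightarrow> real" where
  "form l x t = l * x\<^sup>2 - (l + 1) * t * x + t\<^sup>2"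

lemma form_sums: "form l (a + b) (a + l * b) = - ((l - 1)\<^sup>2 * (a * b))"
  by (simp add: form_def power2_eq_square algebra_simps)

lemma card_form_fibre_le:
  assumes "finite T"
  shows "card {t \<in> T. form l y t = k} \<le> 2"
proof -
  have "{t \<in> T. form l y t = k} \<subseteq> {t. 1 * t\<^sup>2 + (- (l + 1) * y) * t + (l * y\<^sup>2 - k) = 0}"
    by (auto simp: form_def algebra_simps)
  then have "card {t \<in> T. form l y t = k} \<le> card {t. 1 * t\<^sup>2 + (- (l + 1) * y) * t + (l * y\<^sup>2 - k) = 0}"
    by (intro card_mono card_quadratic_roots_le(1)) auto
  also have "\<dots> \<le> 2" by (intro card_quadratic_roots_le(2)) auto
  finally show ?thesis .
qed

text \<open>Completing the square in \<open>x\<close> on both sides, after division by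
  \<open>l\<close>, puts the centre at a multiple of \<open>(t, t')\<close>.\<close>

lemma form_eq_imp_hyperbola:
  assumes "l \<noteq> 0" "form l x t = form l y t'"
  shows "(x - (l + 1) / (2 * l) * t)\<^sup>2 - (y - (l + 1) / (2 * l) * t')\<^sup>2
    = (l - 1)\<^sup>2 / (4 * l\<^sup>2) * (t\<^sup>2 - t'\<^sup>2)"
proof -
  have sq: "(x - (l + 1) / (2 * l) * t)\<^sup>2 = form l x t / l + (l - 1)\<^sup>2 / (4 * l\<^sup>2) * t\<^sup>2" for x t
    using assms(1) by (simp add: form_def field_simps power2_eq_square)
  show ?thesis unfolding sq assms(2) by (simp add: right_diff_distrib)
qed

text \<open>
  The points \<open>(t, t')\<close> of the set below lie on a line and, since \<open>x\<^sup>2 \<noteq> y\<^sup>2\<close>, on a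
  nondegenerate hyperbola.
\<close>

lemma card_common_le_aux:
  assumes l: "l \<notin> {-1, 0, 1}" and xy: "x\<^sup>2 \<noteq> y\<^sup>2" and ne: "x \<noteq> x'"
  shows "finite {(t, t'). form l x t = form l y t' \<and> form l x' t = form l y' t'} \<and>
    card {(t, t'). form l x t = form l y t' \<and> form l x' t = form l y' t'} \<le> 2"
    (is "finite ?C \<and> card ?C \<le> 2")
proof -
  \<comment> \<open>Subtracting the two equations cancels \<open>t\<^sup>2\<close> and
    \<open>t'\<^sup>2\<close>. What remains is linear, with coefficient
    \<open>(l + 1) * (x - x')\<close> at \<open>t\<close>; solving for \<open>t\<close> gives the
    slope \<open>\<alpha>\<close> and intercept \<open>\<beta>\<close>.\<close>
  define \<alpha> where "\<alpha> = (y - y') / (x - x')"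
  define \<beta> where "\<beta> = l * ((x\<^sup>2 - y\<^sup>2) - (x'\<^sup>2 - y'\<^sup>2)) / ((l + 1) * (x - x'))"
  \<comment> \<open>\<open>A\<close>, \<open>B\<close>, \<open>D\<close> are the coefficients in
    \<open>t'\<close> of \<open>form l x t - form l y t'\<close> after the substitution
    \<open>t = \<alpha> * t' + \<beta>\<close>.\<close>
  define A where "A = \<alpha>\<^sup>2 - 1"
  define B where "B = 2 * \<alpha> * \<beta> - (l + 1) * x * \<alpha> + (l + 1) * y"
  define D where "D = \<beta>\<^sup>2 - (l + 1) * x * \<beta> + l * (x\<^sup>2 - y\<^sup>2)"
  have l1: "l + 1 \<noteq> 0" "(l - 1)\<^sup>2 \<noteq> 0" using l by auto
  have line: "t = \<alpha> * t' + \<beta>" if "(t, t') \<in> ?C" for t t'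
  proof -
    have "(l + 1) * (x - x') * t = (l + 1) * (y - y') * t' + l * ((x\<^sup>2 - y\<^sup>2) - (x'\<^sup>2 - y'\<^sup>2))"
      using that by (simp add: form_def algebra_simps)
    then have "t = ((l + 1) * (y - y') * t' + l * ((x\<^sup>2 - y\<^sup>2) - (x'\<^sup>2 - y'\<^sup>2))) / ((l + 1) * (x - x'))"
      using ne l1 by (subst nonzero_eq_divide_eq) (simp_all add: mult.commute)
    also have "\<dots> = \<alpha> * t' + \<beta>" using l1 by (simp add: \<alpha>_def \<beta>_def add_divide_distrib)
    finally show ?thesis .
  qed
  have quad: "A * t'\<^sup>2 + B * t' + D = 0" if "(t, t') \<in> ?C" for t t'
  proof -
    have "form l x (\<alpha> * t' + \<beta>) = form l y t'" using that line[OF that] by simp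
    then show ?thesis
      by (simp add: form_def A_def B_def D_def algebra_simps power2_eq_square)
  qed
  \<comment> \<open>If all three vanished, \<open>A\<close> would give
    \<open>\<alpha>\<^sup>2 = 1\<close> and \<open>B\<close> would determine \<open>\<beta>\<close>;
    then \<open>4 * D\<close> equals \<open>- ((l - 1)\<^sup>2 * (x\<^sup>2 - y\<^sup>2))\<close>,
    which is nonzero.\<close>
  have nz: "A \<noteq> 0 \<or> B \<noteq> 0 \<or> D \<noteq> 0"
  proof (rule ccontr)
    assume "\<not> ?thesis"
    then have z: "A = 0" "B = 0" "D = 0" by auto
    then have a2: "\<alpha>\<^sup>2 = 1" by (simp add: A_def)
    have "2 * \<beta> = 2 * \<beta> * \<alpha>\<^sup>2" using a2 by simp
    also have "\<dots> = \<alpha> * (2 * \<alpha> * \<beta>)" by (simp add: power2_eq_square)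
    also have "2 * \<alpha> * \<beta> = (l + 1) * x * \<alpha> - (l + 1) * y" using z(2) by (simp add: B_def)
    also have "\<alpha> * \<dots> = (l + 1) * (x * \<alpha>\<^sup>2 - y * \<alpha>)"
      by (simp add: power2_eq_square algebra_simps)
    finally have b: "2 * \<beta> = (l + 1) * (x - y * \<alpha>)" using a2 by simp
    have "0 = 4 * D" using z(3) by simp
    also have "\<dots> = (2 * \<beta>)\<^sup>2 - 2 * (l + 1) * x * (2 * \<beta>) + 4 * l * (x\<^sup>2 - y\<^sup>2)"
      by (simp add: D_def power2_eq_square algebra_simps)
    also have "\<dots> = (l + 1)\<^sup>2 * (y\<^sup>2 * \<alpha>\<^sup>2 - x\<^sup>2) + 4 * l * (x\<^sup>2 - y\<^sup>2)"
      unfolding b by (simp add: power2_eq_square algebra_simps)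
    also have "\<dots> = - ((l - 1)\<^sup>2 * (x\<^sup>2 - y\<^sup>2))"
      unfolding a2 by (simp add: power2_eq_square algebra_simps)
    finally show False using l1 xy by simp
  qed
  let ?Z = "{z. A * z\<^sup>2 + B * z + D = 0}"
  have sub: "?C \<subseteq> (\<lambda>z. (\<alpha> * z + \<beta>, z)) ` ?Z"
    using line quad by (force simp: image_iff)
  have fin: "finite ((\<lambda>z. (\<alpha> * z + \<beta>, z)) ` ?Z)"
    using card_quadratic_roots_le(1)[OF nz] by simp
  have "card ?C \<le> card ((\<lambda>z. (\<alpha> * z + \<beta>, z)) ` ?Z)" by (rule card_mono[OF fin sub])
  also have "\<dots> \<le> card ?Z" by (rule card_image_le[OF card_quadratic_roots_le(1)[OF nz]])
  also have "\<dots> \<le> 2" by (rule card_quadratic_roots_le(2)[OF nz])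
  finally show ?thesis using finite_subset[OF sub fin] by simp
qed

text \<open>The collision equations are symmetric under exchanging \<open>(x, t)\<close> with
  \<open>(y, t')\<close>, so the case \<open>x = x'\<close>, where \<open>y \<noteq> y'\<close>,
  reduces to the previous one.\<close>

lemma card_common_le:
  assumes l: "l \<notin> {-1, 0, 1}" and xy: "x\<^sup>2 \<noteq> y\<^sup>2" and ne: "(x, y) \<noteq> (x', y')"
  shows "finite {(t, t'). form l x t = form l y t' \<and> form l x' t = form l y' t'} \<and>
    card {(t, t'). form l x t = form l y t' \<and> form l x' t = form l y' t'} \<le> 2"
    (is "finite ?C \<and> card ?C \<le> 2")
proof (cases "x = x'")
  case False
  then show ?thesis by (rule card_common_le_aux[OF l xy])
next
  case True
  then have "y \<noteq> y'" using ne by simp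
  let ?C' = "{(t', t). form l y t' = form l x t \<and> form l y' t' = form l x' t}"
  have eq: "?C = prod.swap ` ?C'" by (auto simp: image_iff)
  have "finite ?C' \<and> card ?C' \<le> 2"
    by (rule card_common_le_aux[OF l xy[symmetric] \<open>y \<noteq> y'\<close>])
  then show ?thesis unfolding eq using card_image_le[of ?C' prod.swap] by auto
qed

section \<open>Collisions of the form on a grid\<close>

text \<open>Given \<open>(x, t)\<close>, there are two choices \<open>y = x\<close> and
  \<open>y = - x\<close>, and for each at most two roots \<open>t'\<close> of a monic
  quadratic.\<close>

lemma card_form_collisions_diag_le:
  assumes S: "finite S" and T: "finite T"
  shows "card {((x, t), (y, t')) \<in> (S \<times> T) \<times> (S \<times> T). form l x t = form l y t' \<and> x\<^sup>2 = y\<^sup>2}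
    \<le> 4 * (card S * card T)"
proof -
  define F where "F = (\<lambda>(x, t). {(y, t') \<in> S \<times> T. form l x t = form l y t' \<and> x\<^sup>2 = y\<^sup>2})"
  have eq: "{((x, t), (y, t')) \<in> (S \<times> T) \<times> (S \<times> T). form l x t = form l y t' \<and> x\<^sup>2 = y\<^sup>2}
      = Sigma (S \<times> T) F"
    by (auto simp: F_def)
  have F4: "card (F p) \<le> 4" for p
  proof -
    obtain x t where p: "p = (x, t)" by force
    let ?H = "\<lambda>y. Pair y ` {t' \<in> T. form l y t' = form l x t}"
    have H: "card (?H y) \<le> 2" for y
      using card_image_le[of "{t' \<in> T. form l y t' = form l x t}" "Pair y"]
        card_form_fibre_le[OF T, of l y "form l x t"] T by fastforce
    have "F p \<subseteq> ?H x \<union> ?H (- x)"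
      by (auto simp: F_def p power2_eq_iff image_iff)
    then have "card (F p) \<le> card (?H x \<union> ?H (- x))" using T by (intro card_mono) auto
    also have "\<dots> \<le> card (?H x) + card (?H (- x))" by (rule card_Un_le)
    finally show ?thesis using H[of x] H[of "- x"] by linarith
  qed
  have "finite (F p)" for p
    by (rule finite_subset[of _ "S \<times> T"]) (use S T in \<open>auto simp: F_def split: prod.splits\<close>)
  then have "card (Sigma (S \<times> T) F) = (\<Sum>p\<in>S \<times> T. card (F p))"
    using S T by (intro card_SigmaI) auto
  also have "\<dots> \<le> (\<Sum>p\<in>S \<times> T. 4)" by (intro sum_mono F4)
  finally show ?thesis unfolding eq by (simp add: card_cartesian_product)
qed

text \<open>
  Because the points form a Cartesian product, cutting it into blocks replaces the Szemeredi-Trotter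
  theorem.
\<close>

lemma card_form_collisions_off_diag_le:
  assumes S: "finite S" and T: "finite T" and l: "l \<notin> {-1, 0, 1}" and m: "m > 0"
  shows "card {((x, t), (y, t')) \<in> (S \<times> T) \<times> (S \<times> T). form l x t = form l y t' \<and> x\<^sup>2 \<noteq> y\<^sup>2}
    \<le> 8 * (card S div m + 1) * (card T)\<^sup>2 + 2 * (card S * m)\<^sup>2" (is "card ?Q \<le> _")
proof -
  define c where "c = block S m"
  define h where "h = map_prod c c"
  define R where "R = card S div m + 1"
  \<comment> \<open>Incidence of the curve indexed by \<open>(t, t')\<close> with the point
    \<open>(x, y)\<close>. \<open>E g\<close> collects the points on \<open>g\<close>, and
    \<open>W\<close> the ordered pairs of distinct points sharing a cell.\<close>
  define on where "on = (\<lambda>(t, t') (x, y). form l x t = form l y t')"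
  define P where "P = {(x, y) \<in> S \<times> S. x\<^sup>2 \<noteq> y\<^sup>2}"
  define E where "E g = {p \<in> P. on g p}" for g
  define W where "W = {(p, q) \<in> P \<times> P. p \<noteq> q \<and> h p = h q}"
  have fP: "finite P" by (rule finite_subset[of _ "S \<times> S"]) (use S in \<open>auto simp: P_def\<close>)
  have fE: "finite (E g)" for g using fP by (simp add: E_def)
  have fW: "finite W" by (rule finite_subset[of _ "P \<times> P"]) (use fP in \<open>auto simp: W_def\<close>)
  have cells: "card (h ` E g) \<le> 8 * R" for g
  proof -
    obtain t t' where g: "g = (t, t')" by force
    show ?thesis unfolding h_def
    proof (rule card_hyperbola_cells_le[where S = S])
      show "mono_on S c" unfolding c_def by (rule mono_on_block[OF S])
      show "c x < R" for x unfolding c_def R_def by (rule block_less[OF S])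
      show "E g \<subseteq> S \<times> S" by (auto simp: E_def P_def)
      show "(x - (l + 1) / (2 * l) * t)\<^sup>2 - (y - (l + 1) / (2 * l) * t')\<^sup>2
          = (l - 1)\<^sup>2 / (4 * l\<^sup>2) * (t\<^sup>2 - t'\<^sup>2)" if "(x, y) \<in> E g" for x y
        using that l by (intro form_eq_imp_hyperbola) (auto simp: E_def on_def g)
    qed
  qed
  have cardE: "card (E g) \<le> 8 * R + card {w \<in> W. on g (fst w) \<and> on g (snd w)}" for g
  proof -
    have "{(p, q) \<in> E g \<times> E g. p \<noteq> q \<and> h p = h q} = {w \<in> W. on g (fst w) \<and> on g (snd w)}"
      by (auto simp: E_def W_def)
    then show ?thesis
      using card_le_card_image_plus_collisions[OF fE, of g h] cells[of g] by simp
  qed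
  have common: "card {g \<in> T \<times> T. on g (fst w) \<and> on g (snd w)} \<le> 2" if "w \<in> W" for w
  proof -
    obtain x y x' y' where w: "w = ((x, y), (x', y'))" by (metis surj_pair)
    let ?C = "{(t, t'). form l x t = form l y t' \<and> form l x' t = form l y' t'}"
    have "x\<^sup>2 \<noteq> y\<^sup>2" "(x, y) \<noteq> (x', y')" using that by (auto simp: w W_def P_def)
    then have C: "finite ?C \<and> card ?C \<le> 2" by (rule card_common_le[OF l])
    have "{g \<in> T \<times> T. on g (fst w) \<and> on g (snd w)} \<subseteq> ?C" by (auto simp: on_def w)
    then show ?thesis using C card_mono by (meson order_trans)
  qed
  have cardW: "card W \<le> (card S * m)\<^sup>2"
  proof -
    \<comment> \<open>\<open>F p\<close> is the cell of \<open>p\<close>, a product of two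
      blocks.\<close>
    define F where "F = (\<lambda>(x, y). {x' \<in> S. c x' = c x} \<times> {y' \<in> S. c y' = c y})"
    have fF: "finite (F p)" for p using S by (auto simp: F_def split: prod.splits)
    have "card (F p) \<le> m * m" for p
      using card_block_le[OF S m]
      by (auto simp: F_def c_def card_cartesian_product intro!: mult_le_mono split: prod.splits)
    then have "(\<Sum>p\<in>S \<times> S. card (F p)) \<le> (\<Sum>p\<in>S \<times> S. m * m)" by (intro sum_mono)
    moreover have "card W \<le> card (Sigma (S \<times> S) F)"
      using S fF by (intro card_mono finite_SigmaI) (auto simp: W_def P_def F_def h_def)
    moreover have "card (Sigma (S \<times> S) F) = (\<Sum>p\<in>S \<times> S. card (F p))"
      using S fF by (intro card_SigmaI) auto
    ultimately show ?thesis
      by (simp add: card_cartesian_product power2_eq_square mult_ac)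
  qed
  have "card ?Q \<le> card (Sigma (T \<times> T) E)"
    by (rule card_inj_on_le[where f = "\<lambda>((x, t), (y, t')). ((t, t'), (x, y))"])
      (use T fE in \<open>auto simp: inj_on_def E_def P_def on_def\<close>)
  also have "\<dots> = (\<Sum>g\<in>T \<times> T. card (E g))" using T fE by (intro card_SigmaI) auto
  also have "\<dots> \<le> (\<Sum>g\<in>T \<times> T. 8 * R + card {w \<in> W. on g (fst w) \<and> on g (snd w)})"
    by (intro sum_mono cardE)
  also have "\<dots> = 8 * R * (card T)\<^sup>2
      + (\<Sum>g\<in>T \<times> T. card {w \<in> W. on g (fst w) \<and> on g (snd w)})"
    by (simp add: sum.distrib card_cartesian_product power2_eq_square algebra_simps)
  \<comment> \<open>Double counting: summed over pairs instead of curves, each pair in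
    \<open>W\<close> contributes at most 2.\<close>
  also have "(\<Sum>g\<in>T \<times> T. card {w \<in> W. on g (fst w) \<and> on g (snd w)})
      = (\<Sum>w\<in>W. card {g \<in> T \<times> T. on g (fst w) \<and> on g (snd w)})"
    using T fW by (intro sum_multicount_gen) auto
  also have "\<dots> \<le> (\<Sum>w\<in>W. 2)" by (intro sum_mono common)
  also have "\<dots> \<le> 2 * (card S * m)\<^sup>2" using cardW by simp
  finally show ?thesis by (simp add: R_def)
qed

lemma card_form_collisions_le:
  assumes S: "finite S" and T: "finite T" and l: "l \<notin> {-1, 0, 1}"
    and N: "card S \<le> N" "card T \<le> N" "N > 0"
  shows "real (card {((x, t), (y, t')) \<in> (S \<times> T) \<times> (S \<times> T). form l x t = form l y t'})
    \<le> 28 * real N powr (8 / 3)" (is "real (card ?Q) \<le> _")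
proof -
  define n where "n = real N"
  \<comment> \<open>This size balances \<open>n ^ 3 / m\<close> against
    \<open>n\<^sup>2 * m\<^sup>2\<close>; rounding up at most doubles it because
    \<open>n \<ge> 1\<close>.\<close>
  define m where "m = nat \<lceil>n powr (1 / 3)\<rceil>"
  have n1: "n \<ge> 1" using N(3) by (simp add: n_def)
  then have p1: "n powr (1 / 3) \<ge> 1" by (intro ge_one_powr_ge_zero) auto
  have m_ge: "n powr (1 / 3) \<le> real m" unfolding m_def by (rule real_nat_ceiling_ge)
  have m_le: "real m \<le> 2 * n powr (1 / 3)"
    using p1 unfolding m_def by linarith
  have m0: "m > 0" using m_ge p1 by (cases m) auto
  have "?Q \<subseteq> {((x, t), (y, t')) \<in> (S \<times> T) \<times> (S \<times> T). form l x t = form l y t' \<and> x\<^sup>2 = y\<^sup>2}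
      \<union> {((x, t), (y, t')) \<in> (S \<times> T) \<times> (S \<times> T). form l x t = form l y t' \<and> x\<^sup>2 \<noteq> y\<^sup>2}"
    (is "_ \<subseteq> ?D \<union> ?O")
    by auto
  moreover have "finite (?D \<union> ?O)"
    by (rule finite_subset[of _ "(S \<times> T) \<times> (S \<times> T)"]) (use S T in auto)
  ultimately have "card ?Q \<le> card ?D + card ?O"
    by (meson card_Un_le card_mono order_trans)
  also have "\<dots> \<le> 4 * (card S * card T)
      + (8 * (card S div m + 1) * (card T)\<^sup>2 + 2 * (card S * m)\<^sup>2)"
    by (intro add_mono card_form_collisions_diag_le card_form_collisions_off_diag_le S T l m0)
  also have "\<dots> \<le> 4 * (N * N) + (8 * (N div m + 1) * N\<^sup>2 + 2 * (N * m)\<^sup>2)"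
    using N by (intro add_mono mult_mono power_mono div_le_mono) auto
  finally have "real (card ?Q) \<le> real (4 * (N * N) + (8 * (N div m + 1) * N\<^sup>2 + 2 * (N * m)\<^sup>2))"
    by (rule of_nat_mono)
  also have "\<dots> = 4 * n\<^sup>2 + 8 * (real (N div m) + 1) * n\<^sup>2 + 2 * n\<^sup>2 * (real m)\<^sup>2"
    unfolding n_def by (simp add: power2_eq_square)
  finally have Q: "real (card ?Q) \<le> 4 * n\<^sup>2 + 8 * (real (N div m) + 1) * n\<^sup>2 + 2 * n\<^sup>2 * (real m)\<^sup>2" .
  have n2: "n\<^sup>2 = n powr 2" using n1 by simp
  have "real (N div m) \<le> n / real m" unfolding n_def by (rule of_nat_div_le_of_nat)
  also have "\<dots> \<le> n / n powr (1 / 3)" using m_ge p1 n1 by (intro divide_left_mono) auto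
  also have "\<dots> = n powr (2 / 3)" using n1 powr_diff[of n 1 "1 / 3"] by simp
  finally have d: "real (N div m) \<le> n powr (2 / 3)" .
  have q1: "n powr (2 / 3) \<ge> 1" using n1 by (intro ge_one_powr_ge_zero) auto
  have "(real m)\<^sup>2 \<le> (2 * n powr (1 / 3))\<^sup>2" using m_le by (intro power_mono) auto
  also have "\<dots> = 4 * n powr (2 / 3)"
    using n1 by (simp add: power2_eq_square flip: powr_add)
  finally have mm: "(real m)\<^sup>2 \<le> 4 * n powr (2 / 3)" .
  have "4 * n\<^sup>2 + 8 * (real (N div m) + 1) * n\<^sup>2 + 2 * n\<^sup>2 * (real m)\<^sup>2
      = (12 + 8 * real (N div m) + 2 * (real m)\<^sup>2) * n\<^sup>2"
    by (simp add: algebra_simps)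
  \<comment> \<open>28 is 12 + 8 + 2 * 4, the lone 12 being absorbed by
    \<open>n powr (2 / 3) \<ge> 1\<close>.\<close>
  also have "\<dots> \<le> (28 * n powr (2 / 3)) * n\<^sup>2"
    using d mm q1 by (intro mult_right_mono) auto
  also have "\<dots> = 28 * n powr (8 / 3)"
    unfolding n2 by (subst mult.assoc, subst powr_add[symmetric]) simp
  finally show ?thesis using Q by (simp add: n_def)
qed

section \<open>From the graph to the grid, and the final exponent\<close>

lemma finite_along:
  assumes "finite G"
  shows "finite (sum_along G)" "finite (dilated_sum_along l G)" "finite (prod_along G)"
proof -
  have "sum_along G = (\<lambda>(a, b). a + b) ` G" "dilated_sum_along l G = (\<lambda>(a, b). a + l * b) ` G"
    "prod_along G = (\<lambda>(a, b). a * b) ` G"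
    by (force simp: sum_along_def dilated_sum_along_def prod_along_def)+
  then show "finite (sum_along G)" "finite (dilated_sum_along l G)" "finite (prod_along G)"
    using assms by simp_all
qed

lemma card_squared_along_le:
  assumes G: "finite G" "G \<noteq> {}" and l: "l \<notin> {-1, 0, 1}"
    and N: "card (sum_along G) \<le> N" "card (dilated_sum_along l G) \<le> N" "card (prod_along G) \<le> N"
  shows "(real (card G))\<^sup>2 \<le> 28 * real N powr (11 / 3)"
proof -
  let ?S = "sum_along G" and ?T = "dilated_sum_along l G" and ?P = "prod_along G"
  let ?Q = "{((x, t), (y, t')) \<in> (?S \<times> ?T) \<times> (?S \<times> ?T). form l x t = form l y t'}"
  have fin: "finite ?S" "finite ?T" "finite ?P" by (rule finite_along[OF G(1)])+
  have img: "(\<lambda>(a, b). a * b) ` G = ?P" by (force simp: prod_along_def)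
  have "?P \<noteq> {}" using G(2) img by blast
  then have N0: "N > 0" using N(3) fin(3) by (metis card_gt_0_iff le_zero_eq neq0_conv)
  \<comment> \<open>An injective change of coordinates, as \<open>l \<noteq> 1\<close>, which by
    \<open>form_sums\<close> carries collisions of the product on \<open>G\<close> to collisions of
    the form on the grid.\<close>
  define \<phi> where "\<phi> = (\<lambda>(a, b). (a + b, a + l * b))"
  have inj: "p = q" if "\<phi> p = \<phi> q" for p q
  proof -
    obtain a b a' b' where pq: "p = (a, b)" "q = (a', b')" by force
    have e: "a + b = a' + b'" "a + l * b = a' + l * b'" using that by (auto simp: pq \<phi>_def)
    then have "(l - 1) * (b - b') = 0" by (simp add: algebra_simps)
    then show ?thesis using l e by (auto simp: pq)
  qed
  have "card {(p, q) \<in> G \<times> G. (\<lambda>(a, b). a * b) p = (\<lambda>(a, b). a * b) q} \<le> card ?Q"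
  proof (rule card_inj_on_le[where f = "map_prod \<phi> \<phi>"])
    show "inj_on (map_prod \<phi> \<phi>) {(p, q) \<in> G \<times> G. (\<lambda>(a, b). a * b) p = (\<lambda>(a, b). a * b) q}"
      using inj by (auto simp: inj_on_def)
    show "finite ?Q" by (rule finite_subset[of _ "(?S \<times> ?T) \<times> (?S \<times> ?T)"]) (use fin in auto)
    show "map_prod \<phi> \<phi> ` {(p, q) \<in> G \<times> G. (\<lambda>(a, b). a * b) p = (\<lambda>(a, b). a * b) q} \<subseteq> ?Q"
      by (auto simp: \<phi>_def form_sums sum_along_def dilated_sum_along_def)
  qed
  then have "real (card {(p, q) \<in> G \<times> G. (\<lambda>(a, b). a * b) p = (\<lambda>(a, b). a * b) q})
      \<le> 28 * real N powr (8 / 3)"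
    using card_form_collisions_le[OF fin(1,2) l N(1,2) N0] by linarith
  then have "(real (card G))\<^sup>2 \<le> real N * (28 * real N powr (8 / 3))"
    using card_squared_le_card_image_times_collisions[OF G(1), of "\<lambda>(a, b). a * b"] N(3)
    unfolding img by (smt (verit) mult_mono of_nat_0_le_iff of_nat_mono)
  also have "\<dots> = 28 * (real N powr 1 * real N powr (8 / 3))" by simp
  also have "real N powr 1 * real N powr (8 / 3) = real N powr (11 / 3)"
    by (subst powr_add[symmetric]) simp
  finally show ?thesis .
qed

theorem theorem1p1:
  shows "\<exists>c::real. c > 0 \<and>
    (\<forall>(A::real set) (B::real set) (G::(real \<times> real) set) (l::real).
       finite A \<longrightarrow> finite B \<longrightarrow> G \<subseteq> A \<times> B \<longrightarrow> l \<notin> {-1, 0, 1} \<longrightarrow>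
       real (Max {card (sum_along G), card (dilated_sum_along l G), card (prod_along G)})
         \<ge> c * real (card G) powr (6 / 11))"
proof (intro exI[of _ "(1 / 28) powr (3 / 11)"] conjI allI impI)
  show "(0::real) < (1 / 28) powr (3 / 11)" by simp
next
  fix A B :: "real set" and G :: "(real \<times> real) set" and l :: real
  assume AB: "finite A" "finite B" "G \<subseteq> A \<times> B" and l: "l \<notin> {-1, 0, 1}"
  define N where "N = Max {card (sum_along G), card (dilated_sum_along l G), card (prod_along G)}"
  have fG: "finite G" using AB finite_subset by blast
  have "(1 / 28) powr (3 / 11) * real (card G) powr (6 / 11) \<le> real N"
  \<comment> \<open>For empty \<open>G\<close> the left side is 0, since
    \<open>0 powr (6 / 11) = 0\<close>.\<close>
  proof (cases "G = {}")
    case False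
    have "(real (card G))\<^sup>2 \<le> 28 * real N powr (11 / 3)"
      by (rule card_squared_along_le[OF fG False l]) (auto simp: N_def)
    \<comment> \<open>The power 3/11 inverts 11/3 on the right, turns the square into exponent 6/11,
      and turns 1/28 into the chosen constant.\<close>
    then have "((1 / 28) * (real (card G))\<^sup>2) powr (3 / 11) \<le> (real N powr (11 / 3)) powr (3 / 11)"
      by (intro powr_mono2) auto
    also have "\<dots> = real N" by (simp add: powr_powr)
    also have "((1 / 28) * (real (card G))\<^sup>2) powr (3 / 11)
        = (1 / 28) powr (3 / 11) * ((real (card G)) powr 2) powr (3 / 11)"
      by (subst powr_mult) auto
    finally show ?thesis by (subst (asm) powr_powr) simp
  qed simp
  then show "(1 / 28) powr (3 / 11) * real (card G) powr (6 / 11)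
      \<le> real (Max {card (sum_along G), card (dilated_sum_along l G), card (prod_along G)})"
    by (simp add: N_def)
qed

end
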